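(* Let $\nu=(\nu_0,\dots,\nu_n)$ be a lattice path and let $\delta=(\delta_1,\dots,\delta_n)$ be an increment vector with respect to $\nu$. Then the alt $\nu$-Tamari poset $\operatorname{Tam}_\nu(\delta)$ is a lattice.
   Context: Lattice paths: a path from $(0,0)$ to $(m,n)$ with unit north steps $N$ and east steps $E$ is encoded by $\nu=(\nu_0,\dots,\nu_n)$ with $\nu_i\ge 0$ integers, where $n$ is the number of north steps, $\nu_0$ is the number of initial east steps, and $\nu_i$ ($i\ge1$) is the number of consecutive east steps immediately following the $i$-th north step; $m=\nu_0+\dots+\nu_n$. A $\nu$-path is a lattice path $\mu$ with north and east unit steps, with the same endpoints as $\nu$, lying weakly above $\nu$; equivalently $\mu=(\mu_0,\dots,\mu_n)$ with $\mu_i\ge0$ and $\sum_{i=0}^j\mu_i\le\sum_{i=0}^j\nu_i$ for all $0\le j\le n$, with equality for $j=n$. An increment vector with respect to $\nu$ is $\delta=(\delta_1,\dots,\delta_n)\in\mathbb{N}^n$ with $0\le\delta_i\le\nu_i$ for all $1\le i\le n$. The $\delta$-altitude of the lattice points of a $\nu$-path $\mu$ is defined as follows: the initial point has $\delta$-altitude $0$, the $i$-th north step of $\mu$ increases the $\delta$-altitude by $\delta_i$, and each east step decreases it by $1$. Given a valley $EN$ of $\mu$ (an east step immediately followed by a north step), let $p$ be the lattice point between these two steps, let $q$ be the next lattice point of $\mu$ after $p$ with the same $\delta$-altitude as $p$, and let $\mu_{[p,q]}$ be the subpath of $\mu$ from $p$ to $q$. The $\delta$-rotation of $\mu$ at $p$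 is the path $\mu'$ obtained from $\mu$ by switching $\mu_{[p,q]}$ with the east step $E$ that precedes it; write $\mu\lessdot_\delta\mu'$. The alt $\nu$-Tamari poset $\operatorname{Tam}_\nu(\delta)$ is the reflexive transitive closure of $\delta$-rotations on the set of $\nu$-paths. *)

theory Defs
  imports "HOL-Algebra.Lattice"
begin

text \<open>
  A lattice path from the origin with \<open>n\<close> north steps is encoded by the list
  \<open>[\<mu>\<^sub>0, \<dots>, \<mu>\<^sub>n]\<close>: \<open>\<mu>\<^sub>0\<close> east steps first, then \<open>\<mu>\<^sub>i\<close> east steps right after the
  \<open>i\<close>-th north step.  The encoding list is never empty, and \<open>n = length \<mu> - 1\<close>.
\<close>

datatype step = North | East

definition steps :: "nat list \<Rightarrow> step list" where
  "steps \<mu> = replicate (hd \<mu>) East @ concat (map (\<lambda>k. North # replicate k East) (tl \<mu>))"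

definition nu_paths :: "nat list \<Rightarrow> nat list set" where
  "nu_paths \<nu> = {\<mu>. length \<mu> = length \<nu> \<and>
     (\<forall>j < length \<nu>. (\<Sum>i\<le>j. \<mu> ! i) \<le> (\<Sum>i\<le>j. \<nu> ! i)) \<and>
     sum_list \<mu> = sum_list \<nu>}"

text \<open>
  Lists are indexed from 0, so \<open>\<delta>\<^sub>i\<close> (for \<open>1 \<le> i \<le> n\<close>) is \<open>\<delta> ! (i - 1)\<close>, whereas
  \<open>\<nu>\<^sub>i\<close> (for \<open>0 \<le> i \<le> n\<close>) is \<open>\<nu> ! i\<close>.
\<close>

definition increment_vector :: "nat list \<Rightarrow> nat list \<Rightarrow> bool" where
  "increment_vector \<nu> \<delta> \<longleftrightarrow>
     length \<delta> = length \<nu> - 1 \<and> (\<forall>i \<in> {1..length \<nu> - 1}. \<delta> ! (i - 1) \<le> \<nu> ! i)"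

text \<open>
  The lattice points of a path with step word \<open>w\<close> are numbered by \<open>0, \<dots>, length w\<close>;
  point \<open>k\<close> is the one reached after \<open>k\<close> steps.
\<close>

definition altitude :: "nat list \<Rightarrow> step list \<Rightarrow> nat \<Rightarrow> int" where
  "altitude \<delta> w k =
     (\<Sum>i = 1..count_list (take k w) North. int (\<delta> ! (i - 1))) - int (count_list (take k w) East)"

text \<open>
  The path rotates at point \<open>p\<close>, a valley, and \<open>q\<close> is the next point of equal altitude.  The
  length condition only rules out \<open>\<mu>' = []\<close>, which encodes no path.
\<close>

definition rotation :: "nat list \<Rightarrow> nat list \<Rightarrow> nat list \<Rightarrow> bool" where
  "rotation \<delta> \<mu> \<mu>' \<longleftrightarrow>
     length \<mu>' = length \<mu> \<and>
     (let w = steps \<mu> in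
      \<exists>p q. 0 < p \<and> p < q \<and> q \<le> length w \<and>
        w ! (p - 1) = East \<and> w ! p = North \<and>
        altitude \<delta> w q = altitude \<delta> w p \<and>
        (\<forall>r. p < r \<and> r < q \<longrightarrow> altitude \<delta> w r \<noteq> altitude \<delta> w p) \<and>
        steps \<mu>' = take (p - 1) w @ drop p (take q w) @ [East] @ drop q w)"

definition alt_tamari :: "nat list \<Rightarrow> nat list \<Rightarrow> nat list gorder" where
  "alt_tamari \<nu> \<delta> =
     \<lparr>carrier = nu_paths \<nu>,
      eq = (=),
      le = (\<lambda>\<mu> \<mu>'. \<mu> \<in> nu_paths \<nu> \<and> rotation \<delta> \<mu> \<mu>')\<^sup>*\<^sup>*\<rparr>"

end

theory Submission
  imports Defs
begin

text \<open>
  A path is read as a stack machine.  Row \<open>k\<close> of a path (its \<open>k\<close>-th north step, none for row 0, and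
  the east steps after it) first pushes \<open>d k\<close> units and then pops one unit for each east step.  For
  \<open>k \<ge> 1\<close> the supply \<open>d k\<close> is \<open>\<delta>\<^sub>k\<close>, and \<open>d 0\<close> is the surplus of east steps over these, so that the
  stack height differs from the \<open>\<delta>\<close>-altitude by a constant and is 0 at the end.  The hypothesis
  \<open>\<delta>\<^sub>k \<le> \<nu>\<^sub>k\<close> implies that \<open>\<nu>\<close> lies weakly above the path with encoding \<open>d\<close>; hence so does each
  \<open>\<nu>\<close>-path, and its stack never underflows.

  A \<open>\<delta>\<close>-rotation at a valley takes the unit popped by the last east step of a row and lets it wait on
  the stack until the units of the next row, which lie above it, are gone.  The order is therefore
  recorded by the set of all triples \<open>(i, c, k)\<close> such that the \<open>c\<close>-th unit pushed by row \<open>i\<close> is still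
  pending at the beginning of row \<open>k\<close>.  Three facts give the lattice.

  First, a set of triples comes from a path if and only if it is a \<open>bracketing\<close>: closed under
  shortening the waiting time, under passing to deeper units of the same row, and under the
  composition of \<open>(i, c, j)\<close> with \<open>(j, b, k)\<close> to \<open>(i, c, k)\<close>, which says that units are popped last in,
  first out.  The path is recovered by counting the pending units (\<open>depth_pending\<close>, \<open>pending_depth\<close>).
  All these conditions are Horn clauses, so bracketings are closed under intersection.

  Second, one path is reached from another by rotations if and only if its set of pending triples
  contains that of the other (\<open>rotations_iff_path_pending_subset\<close>).  A rotation only makes units wait longer; conversely
  \<open>rotation_towards\<close> finds, below any larger set, a rotation to start with.

  Third, the \<open>\<nu>\<close>-paths are exactly the paths whose triples include those of \<open>\<nu>\<close>
  (\<open>nu_paths_iff_path_pending\<close>), again because \<open>\<delta>\<^sub>k \<le> \<nu>\<^sub>k\<close>.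

  So the poset is a family of sets ordered by inclusion, closed under nonempty intersections and with
  a largest member.  Such a family is a lattice: meets are intersections, and a join is the
  intersection of all upper bounds.
\<close>

section \<open>Height profiles and their pending units\<close>

text \<open>
  \<open>P k\<close> is the stack height at the beginning of row \<open>k\<close>.  Since the rows are \<open>0, \<dots>, N - 1\<close>, the value
  at \<open>N\<close> is the final height; larger arguments are also sent to 0, so that a profile is determined
  by its path.
\<close>

definition height_profiles :: "nat \<Rightarrow> (nat \<Rightarrow> nat) \<Rightarrow> (nat \<Rightarrow> nat) set" where
  "height_profiles N d =
     {P. P 0 = 0 \<and> (\<forall>k\<ge>N. P k = 0) \<and> (\<forall>k<N. P (Suc k) \<le> P k + d k)}"

text \<open>
  The units of row \<open>i\<close> occupy the levels \<open>P i + 1, \<dots>, P i + d i\<close>, and a unit is popped when the height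
  first drops below its level.
\<close>

definition pending :: "(nat \<Rightarrow> nat) \<Rightarrow> (nat \<Rightarrow> nat) \<Rightarrow> (nat \<times> nat \<times> nat) set" where
  "pending d P =
     {(i, c, k). i < k \<and> 1 \<le> c \<and> c \<le> d i \<and> (\<forall>l\<in>{i<..k}. P i + c \<le> P l)}"

definition bracketing :: "nat \<Rightarrow> (nat \<Rightarrow> nat) \<Rightarrow> (nat \<times> nat \<times> nat) set \<Rightarrow> bool" where
  "bracketing N d X \<longleftrightarrow>
     (\<forall>i c k. (i, c, k) \<in> X \<longrightarrow> i < k \<and> k < N \<and> 1 \<le> c \<and> c \<le> d i) \<and>
     (\<forall>i c k l. (i, c, k) \<in> X \<longrightarrow> i < l \<longrightarrow> l \<le> k \<longrightarrow> (i, c, l) \<in> X) \<and>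
     (\<forall>i c b k. (i, c, k) \<in> X \<longrightarrow> 1 \<le> b \<longrightarrow> b \<le> c \<longrightarrow> (i, b, k) \<in> X) \<and>
     (\<forall>i c j b k. (i, c, j) \<in> X \<longrightarrow> (j, b, k) \<in> X \<longrightarrow> (i, c, k) \<in> X)"

definition depth :: "(nat \<times> nat \<times> nat) set \<Rightarrow> nat \<Rightarrow> nat" where
  "depth X k = card {(i, c). (i, c, k) \<in> X}"

lemma bracketing_pending:
  assumes "P \<in> height_profiles N d"
  shows "bracketing N d (pending d P)"
proof -
  have bound: "k < N" if "(i, c, k) \<in> pending d P" for i c k
  proof (rule ccontr)
    assume "\<not> k < N"
    then have "P k = 0" using assms by (simp add: height_profiles_def)
    then show False using that by (force simp: pending_def)
  qed
  have trans: "(i, c, k) \<in> pending d P"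
    if ic: "(i, c, j) \<in> pending d P" and jb: "(j, b, k) \<in> pending d P" for i c j b k
  proof -
    have "P i + c \<le> P l" if l: "i < l" "l \<le> k" for l
    proof (cases "l \<le> j")
      case True
      then show ?thesis using ic l by (auto simp: pending_def)
    next
      case False
      then have "P j + b \<le> P l" using jb l by (auto simp: pending_def)
      moreover have "P i + c \<le> P j" using ic by (auto simp: pending_def)
      ultimately show ?thesis by simp
    qed
    then show ?thesis using ic jb by (auto simp: pending_def)
  qed
  have lower: "(i, b, k) \<in> pending d P"
    if "(i, c, k) \<in> pending d P" "1 \<le> b" "b \<le> c" for i c b k
    using that by (fastforce simp: pending_def)
  have earlier: "(i, c, l) \<in> pending d P"
    if "(i, c, k) \<in> pending d P" "i < l" "l \<le> k" for i c k l
    using that by (auto simp: pending_def)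
  have range: "i < k \<and> 1 \<le> c \<and> c \<le> d i" if "(i, c, k) \<in> pending d P" for i c k
    using that by (auto simp: pending_def)
  show ?thesis
    unfolding bracketing_def using bound trans lower earlier range by blast
qed

lemma bracketing_Inter:
  assumes "F \<noteq> {}" "\<And>X. X \<in> F \<Longrightarrow> bracketing N d X"
  shows "bracketing N d (\<Inter>F)"
proof -
  obtain X where X: "X \<in> F" using assms(1) by blast
  have "\<forall>i c k. (i, c, k) \<in> \<Inter>F \<longrightarrow> i < k \<and> k < N \<and> 1 \<le> c \<and> c \<le> d i"
    using assms(2)[OF X] X unfolding bracketing_def by blast
  moreover have "\<forall>i c k l. (i, c, k) \<in> \<Inter>F \<longrightarrow> i < l \<longrightarrow> l \<le> k \<longrightarrow> (i, c, l) \<in> \<Inter>F"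
    using assms(2) unfolding bracketing_def by blast
  moreover have "\<forall>i c b k. (i, c, k) \<in> \<Inter>F \<longrightarrow> 1 \<le> b \<longrightarrow> b \<le> c \<longrightarrow> (i, b, k) \<in> \<Inter>F"
    using assms(2) unfolding bracketing_def by blast
  moreover have "\<forall>i c j b k. (i, c, j) \<in> \<Inter>F \<longrightarrow> (j, b, k) \<in> \<Inter>F \<longrightarrow> (i, c, k) \<in> \<Inter>F"
    using assms(2) unfolding bracketing_def by blast
  ultimately show ?thesis unfolding bracketing_def by blast
qed

lemma finite_bracketing_slice:
  assumes "bracketing N d X"
  shows "finite {(i, c). (i, c, k) \<in> X}"
proof (rule finite_subset)
  show "{(i, c). (i, c, k) \<in> X} \<subseteq> Sigma {..<k} (\<lambda>i. {..d i})"
    using assms unfolding bracketing_def by blast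
qed auto

lemma depth_mono:
  assumes "bracketing N d Y" "X \<subseteq> Y"
  shows "depth X k \<le> depth Y k"
  unfolding depth_def
  by (rule card_mono[OF finite_bracketing_slice[OF assms(1)]]) (use assms(2) in auto)

text \<open>
  At the beginning of row \<open>t\<close> the stack holds exactly one unit on each of the levels \<open>1, \<dots>, P t\<close>, the
  unit on level \<open>h\<close> having been pushed by the last row that began below level \<open>h\<close>.
\<close>

lemma depth_pending:
  assumes P: "P \<in> height_profiles N d"
  shows "depth (pending d P) = P"
proof
  fix t
  let ?U = "{(i, c). (i, c, t) \<in> pending d P}"
  have "bij_betw (\<lambda>(i, c). P i + c) ?U {1..P t}"
  proof (rule bij_betw_imageI)
    have level: "i = i' \<and> c = c'"
      if U: "(i, c) \<in> ?U" "(i', c') \<in> ?U" and eq: "P i + c = P i' + c'" for i c i' c'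
    proof -
      have "\<not> i < i'" using U eq by (force simp: pending_def)
      moreover have "\<not> i' < i" using U eq by (force simp: pending_def)
      ultimately show ?thesis using eq by simp
    qed
    then show "inj_on (\<lambda>(i, c). P i + c) ?U" by (auto simp: inj_on_def)
    show "(\<lambda>(i, c). P i + c) ` ?U = {1..P t}"
    proof
      show "(\<lambda>(i, c). P i + c) ` ?U \<subseteq> {1..P t}" by (auto simp: pending_def)
      show "{1..P t} \<subseteq> (\<lambda>(i, c). P i + c) ` ?U"
      proof
        fix h assume h: "h \<in> {1..P t}"
        let ?I = "{i. i < t \<and> P i < h}"
        have "t < N"
        proof (rule ccontr)
          assume "\<not> t < N"
          then have "P t = 0" using P by (simp add: height_profiles_def)
          then show False using h by simp
        qed
        have "t \<noteq> 0" using h P by (intro notI) (simp add: height_profiles_def)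
        then have "0 \<in> ?I" using h P by (auto simp: height_profiles_def)
        define i where "i = Max ?I"
        have iI: "i \<in> ?I"
          unfolding i_def by (rule Max_in) (use \<open>0 \<in> ?I\<close> in auto)
        have above: "h \<le> P l" if "i < l" "l \<le> t" for l
        proof (rule ccontr)
          assume "\<not> h \<le> P l"
          then have "l \<in> ?I" using that h by (cases "l = t") auto
          then have "l \<le> i" unfolding i_def by (intro Max_ge) auto
          then show False using that by simp
        qed
        have "h \<le> P (Suc i)" using iI by (intro above) auto
        also have "\<dots> \<le> P i + d i"
          using P iI \<open>t < N\<close> by (auto simp: height_profiles_def)
        finally have "(i, h - P i) \<in> ?U" using iI above by (auto simp: pending_def)
        then show "h \<in> (\<lambda>(i, c). P i + c) ` ?U" using iI by force
      qed
    qed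
  qed
  then show "depth (pending d P) t = P t"
    unfolding depth_def by (auto dest: bij_betw_same_card)
qed

lemma profile_le_if_pending_subset:
  assumes "P \<in> height_profiles N d" "Q \<in> height_profiles N d" "pending d P \<subseteq> pending d Q"
  shows "P k \<le> Q k"
  using depth_mono[OF bracketing_pending[OF assms(2)] assms(3), of k] assms(1,2)
  by (simp add: depth_pending)

text \<open>
  In a bracketing, consider the units pending at \<open>i\<close> together with the lowest \<open>c\<close> units of row \<open>i\<close>.
  As long as the unit \<open>(i, c)\<close> is pending, composition keeps all of them pending, so the depth is at
  least \<open>depth X i + c\<close>.  At the first \<open>l\<close> where \<open>(i, c)\<close> is no longer pending, composition excludes
  every unit pushed after row \<open>i\<close>, so at most \<open>depth X i + (c - 1)\<close> units remain.
\<close>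

lemma pending_depth:
  assumes X: "bracketing N d X"
  shows "depth X \<in> height_profiles N d" "pending d (depth X) = X"
proof -
  define S where "S k = {(i, c). (i, c, k) \<in> X}" for k
  have range: "i < k" "k < N" "1 \<le> c" "c \<le> d i" if "(i, c, k) \<in> X" for i c k
    using X that unfolding bracketing_def by blast+
  have earlier: "(i, c, l) \<in> X" if "(i, c, k) \<in> X" "i < l" "l \<le> k" for i c k l
    using X that unfolding bracketing_def by blast
  have lower: "(i, b, k) \<in> X" if "(i, c, k) \<in> X" "1 \<le> b" "b \<le> c" for i c b k
    using X that unfolding bracketing_def by blast
  have trans: "(i, c, k) \<in> X" if "(i, c, j) \<in> X" "(j, b, k) \<in> X" for i c j b k
    using X that unfolding bracketing_def by blast
  have fin: "finite (S k)" for k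
    unfolding S_def by (rule finite_bracketing_slice[OF X])
  have depth_S: "depth X k = card (S k)" for k
    by (simp add: depth_def S_def)
  have card_fresh: "card (S k \<union> Pair k ` {1..c}) = card (S k) + c" for k c
  proof -
    have "S k \<inter> Pair k ` {1..c} = {}" using range(1) by (fastforce simp: S_def)
    then show ?thesis
      by (simp add: card_Un_disjoint fin card_image inj_on_def)
  qed
  show "depth X \<in> height_profiles N d"
  proof -
    have "S 0 = {}" using range(1) by (fastforce simp: S_def)
    moreover have "S k = {}" if "N \<le> k" for k using range(2) that by (fastforce simp: S_def)
    moreover have "card (S (Suc k)) \<le> card (S k) + d k" for k
    proof -
      have "S (Suc k) \<subseteq> S k \<union> Pair k ` {1..d k}"
      proof
        fix u assume "u \<in> S (Suc k)"
        then obtain i c where u: "u = (i, c)" and ic: "(i, c, Suc k) \<in> X" by (auto simp: S_def)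
        show "u \<in> S k \<union> Pair k ` {1..d k}"
        proof (cases "i = k")
          case True
          then show ?thesis using u range[OF ic] by auto
        next
          case False
          then have "(i, c, k) \<in> X" using range(1)[OF ic] by (intro earlier[OF ic]) auto
          then show ?thesis using u by (auto simp: S_def)
        qed
      qed
      then have "card (S (Suc k)) \<le> card (S k \<union> Pair k ` {1..d k})"
        by (intro card_mono) (auto simp: fin)
      then show ?thesis by (simp only: card_fresh)
    qed
    ultimately show ?thesis by (simp add: height_profiles_def depth_S)
  qed
  have up: "card (S i) + c \<le> card (S l)" if icl: "(i, c, l) \<in> X" for i c l
  proof -
    have "S i \<union> Pair i ` {1..c} \<subseteq> S l"
      using trans[OF _ icl] lower[OF icl] by (auto simp: S_def)
    then have "card (S i \<union> Pair i ` {1..c}) \<le> card (S l)" by (intro card_mono fin)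
    then show ?thesis by (simp only: card_fresh)
  qed
  have down: "\<exists>l\<in>{i<..k}. card (S l) < card (S i) + c"
    if ik: "i < k" and c: "1 \<le> c" and not: "(i, c, k) \<notin> X" for i c k
  proof -
    define l where "l = (LEAST l. i < l \<and> (i, c, l) \<notin> X)"
    have l: "i < l \<and> (i, c, l) \<notin> X"
      unfolding l_def by (rule LeastI[of _ k]) (use ik not in auto)
    have "l \<le> k" unfolding l_def by (rule Least_le) (use ik not in auto)
    have before: "(i, c, m) \<in> X" if "i < m" "m < l" for m
      using not_less_Least[of m "\<lambda>l. i < l \<and> (i, c, l) \<notin> X"] that by (auto simp: l_def)
    have "S l \<subseteq> S i \<union> Pair i ` {1..c - 1}"
    proof
      fix u assume "u \<in> S l"
      then obtain j b where u: "u = (j, b)" and jb: "(j, b, l) \<in> X" by (auto simp: S_def)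
      consider "j < i" | "j = i" | "i < j" by linarith
      then show "u \<in> S i \<union> Pair i ` {1..c - 1}"
      proof cases
        case 1
        then have "(j, b, i) \<in> X" using l by (intro earlier[OF jb]) auto
        then show ?thesis using u by (auto simp: S_def)
      next
        case 2
        then have "b < c" using lower[OF jb c] l by (meson not_less)
        then show ?thesis using u 2 range(3)[OF jb] by auto
      next
        case 3
        then have "(i, c, l) \<in> X" using before range(1)[OF jb] trans jb by blast
        then show ?thesis using l by simp
      qed
    qed
    then have "card (S l) \<le> card (S i \<union> Pair i ` {1..c - 1})"
      by (intro card_mono) (auto simp: fin)
    then have "card (S l) < card (S i) + c"
      using c unfolding card_fresh by simp
    then show ?thesis using l \<open>l \<le> k\<close> by auto
  qed
  show "pending d (depth X) = X"
  proof -
    have "(i, c, k) \<in> pending d (depth X) \<longleftrightarrow> (i, c, k) \<in> X" for i c k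
    proof
      assume "(i, c, k) \<in> pending d (depth X)"
      then have "i < k" "1 \<le> c" "\<forall>l\<in>{i<..k}. \<not> card (S l) < card (S i) + c"
        by (auto simp: pending_def depth_S not_less)
      then show "(i, c, k) \<in> X" using down by blast
    next
      assume ick: "(i, c, k) \<in> X"
      then have "\<forall>l\<in>{i<..k}. card (S i) + c \<le> card (S l)"
        using up earlier by auto
      then show "(i, c, k) \<in> pending d (depth X)"
        using range[OF ick] by (simp add: pending_def depth_S)
    qed
    then show ?thesis by auto
  qed
qed

section \<open>Rotations of height profiles\<close>

text \<open>
  The last east step of row \<open>j - 1\<close> is moved to the end of row \<open>K - 1\<close>, the first row from \<open>j\<close> on
  that ends at or below the height of the valley: one more unit is on the stack in between.
\<close>

definition profile_rotation ::
    "nat \<Rightarrow> (nat \<Rightarrow> nat) \<Rightarrow> (nat \<Rightarrow> nat) \<Rightarrow> (nat \<Rightarrow> nat) \<Rightarrow> bool" where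
  "profile_rotation N d P P' \<longleftrightarrow>
     (\<exists>j K. 0 < j \<and> j < K \<and> K \<le> N \<and> P j < P (j - 1) + d (j - 1) \<and>
        P K \<le> P j \<and> (\<forall>l\<in>{j<..<K}. P j < P l) \<and>
        P' = (\<lambda>l. if j \<le> l \<and> l < K then Suc (P l) else P l))"

text \<open>
  Only a unit pushed by one of the raised rows could be popped earlier than before, because its level
  is raised as well.  But it is no longer pending once the height has returned to at most \<open>P j\<close>, and
  until then all heights are raised with it.
\<close>

lemma pending_subset_if_rotation:
  assumes "profile_rotation N d P P'"
  shows "pending d P \<subseteq> pending d P'"
proof -
  obtain j K where jK: "j < K" "P K \<le> P j" "\<forall>l\<in>{j<..<K}. P j < P l"
    and P': "P' = (\<lambda>l. if j \<le> l \<and> l < K then Suc (P l) else P l)"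
    using assms unfolding profile_rotation_def by blast
  have "P' i + c \<le> P' l"
    if "(i, c, k) \<in> pending d P" "l \<in> {i<..k}" for i c k l
  proof -
    have all: "\<forall>m\<in>{i<..k}. P i + c \<le> P m" and c: "1 \<le> c"
      using that(1) by (auto simp: pending_def)
    show ?thesis
    proof (cases "j \<le> i \<and> i < K")
      case True
      have "P j \<le> P i" using True jK(3) by (cases "i = j") (auto intro: less_imp_le)
      then have "\<not> P i + c \<le> P K" using jK(2) c by linarith
      then have "k < K" using all True by (force simp: not_less)
      then show ?thesis using True that(2) all by (auto simp: P')
    next
      case False
      then show ?thesis using all that(2) by (auto simp: P' intro: le_SucI)
    qed
  qed
  then show ?thesis by (auto simp: pending_def)
qed

text \<open>
  The rotation is made at the first valley where \<open>Q\<close> is higher than \<open>P\<close>.  It changes the waiting time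
  of the unit on level \<open>P j + 1\<close> only.  Since both profiles agree before \<open>j\<close> and \<open>Q\<close> is higher at \<open>j\<close>,
  this unit is pending in \<open>Q\<close> at \<open>j\<close>; and by composition it waits in \<open>Q\<close> for the lowest unit of row
  \<open>j\<close>, which in \<open>Q\<close> is popped no earlier than in \<open>P\<close>.
\<close>

lemma rotation_towards:
  assumes P: "P \<in> height_profiles N d" and Q: "Q \<in> height_profiles N d"
    and sub: "pending d P \<subseteq> pending d Q" and neq: "P \<noteq> Q"
  obtains P' where "profile_rotation N d P P'" "pending d P' \<subseteq> pending d Q"
proof -
  have PQ: "P k \<le> Q k" for k by (rule profile_le_if_pending_subset[OF P Q sub])
  define j where "j = (LEAST j. P j \<noteq> Q j)"
  have "\<exists>j. P j \<noteq> Q j" using neq by auto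
  then have "P j \<noteq> Q j" unfolding j_def by (rule LeastI_ex)
  then have j: "P j < Q j" using PQ[of j] by simp
  have agree: "P l = Q l" if "l < j" for l
    using not_less_Least[of l "\<lambda>j. P j \<noteq> Q j"] that by (simp add: j_def)
  have j0: "0 < j" using j P Q by (cases j) (auto simp: height_profiles_def)
  have jN: "j < N"
  proof (rule ccontr)
    assume "\<not> j < N"
    then have "Q j = 0" using Q by (simp add: height_profiles_def)
    then show False using j by simp
  qed
  define K where "K = (LEAST K. j < K \<and> P K \<le> P j)"
  have PN: "P N = 0" using P by (simp add: height_profiles_def)
  have K: "j < K \<and> P K \<le> P j"
    unfolding K_def by (rule LeastI[of _ N]) (use jN PN in auto)
  have KN: "K \<le> N" unfolding K_def by (rule Least_le) (use jN PN in auto)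
  have between: "P j < P l" if "j < l" "l < K" for l
    using not_less_Least[of l "\<lambda>K. j < K \<and> P K \<le> P j"] that by (auto simp: K_def)
  have "\<forall>k<N. Q (Suc k) \<le> Q k + d k" using Q by (simp add: height_profiles_def)
  moreover have "j - 1 < N" using jN by simp
  ultimately have "Q (Suc (j - 1)) \<le> Q (j - 1) + d (j - 1)" by blast
  then have slack: "P j < P (j - 1) + d (j - 1)"
    using j j0 agree[of "j - 1"] by simp
  define P' where "P' = (\<lambda>l. if j \<le> l \<and> l < K then Suc (P l) else P l)"
  have "profile_rotation N d P P'"
    unfolding profile_rotation_def P'_def using j0 K KN slack between by (intro exI[of _ j] exI[of _ K]) auto
  moreover have "pending d P' \<subseteq> pending d Q"
  proof clarify
    fix a b k assume ab: "(a, b, k) \<in> pending d P'"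
    then have ak: "a < k" and b: "1 \<le> b" "b \<le> d a"
      and le: "\<And>l. a < l \<Longrightarrow> l \<le> k \<Longrightarrow> P' a + b \<le> P' l"
      by (auto simp: pending_def)
    show "(a, b, k) \<in> pending d Q"
    proof (cases "(a, b, k) \<in> pending d P")
      case True
      then show ?thesis using sub by blast
    next
      case False
      then obtain l where l: "a < l" "l \<le> k" "P l < P a + b"
        using ak b by (auto simp: pending_def not_le)
      \<comment> \<open>A triple that is new in \<open>P'\<close> belongs to the unit on level \<open>P j + 1\<close>, no longer pending in \<open>P\<close> at \<open>j\<close>.\<close>
      have lK: "j \<le> l" "l < K" and Pl: "P a + b = Suc (P l)" and aj: "a < j"
        using le[OF l(1,2)] l by (auto simp: P'_def split: if_splits)
      have "P a + b \<le> Suc (P j)"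
        using le[of j] aj lK l K by (auto simp: P'_def)
      then have lj: "l = j" using Pl between[of l] lK by (cases "l = j") auto
      have abj: "(a, b, j) \<in> pending d Q"
      proof -
        have "Q a + b \<le> Q m" if "a < m" "m \<le> j" for m
        proof (cases "m = j")
          case True
          then show ?thesis using Pl lj j agree[OF aj] by simp
        next
          case False
          then have "m < j" using that by simp
          then show ?thesis
            using le[of m] that l lj agree[of m] agree[OF aj] aj by (simp add: P'_def)
        qed
        then show ?thesis using aj b by (simp add: pending_def)
      qed
      have kK: "k < K"
      proof (rule ccontr)
        assume "\<not> k < K"
        then have "P a + b \<le> P K" using le[of K] aj K by (auto simp: P'_def)
        then show False using K Pl lj by simp
      qed
      show ?thesis
      proof (cases "k = j")
        case True
        then show ?thesis using abj by simp
      next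
        case False
        then have jk: "j < k" using l lj by simp
        have "P j < P (Suc j)" using jk kK by (intro between) auto
        also have "\<dots> \<le> P j + d j" using P jN by (simp add: height_profiles_def)
        finally have "(j, 1, k) \<in> pending d P"
          using jk kK between by (auto simp: pending_def Suc_le_eq)
        then have "(j, 1, k) \<in> pending d Q" using sub by blast
        then show ?thesis
          using abj bracketing_pending[OF Q] unfolding bracketing_def by blast
      qed
    qed
  qed
  ultimately show thesis by (rule that)
qed

lemma profile_rotation_closed:
  assumes "P \<in> height_profiles N d" "profile_rotation N d P P'"
  shows "P' \<in> height_profiles N d"
proof -
  obtain j K where jK: "0 < j" "j < K" "K \<le> N" "P j < P (j - 1) + d (j - 1)"
    and P': "P' = (\<lambda>l. if j \<le> l \<and> l < K then Suc (P l) else P l)"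
    using assms(2) unfolding profile_rotation_def by blast
  have "P' (Suc k) \<le> P' k + d k" if "k < N" for k
  proof (cases "Suc k = j")
    case True
    then show ?thesis using jK by (auto simp: P')
  next
    case False
    then show ?thesis
      using assms(1) that by (auto simp: P' height_profiles_def intro: le_SucI)
  qed
  then show ?thesis using assms(1) jK by (auto simp: P' height_profiles_def)
qed

lemma profile_rotation_sum_less:
  assumes "profile_rotation N d P P'"
  shows "sum P {..N} < sum P' {..N}"
proof -
  obtain j K where jK: "j < K" "K \<le> N"
    and P': "P' = (\<lambda>l. if j \<le> l \<and> l < K then Suc (P l) else P l)"
    using assms unfolding profile_rotation_def by blast
  show ?thesis by (rule sum_strict_mono_ex1) (use jK in \<open>auto simp: P' intro!: bexI[of _ j]\<close>)
qed


section \<open>Paths as height profiles\<close>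

text \<open>
  The subtraction is a true one for the members of \<open>nu_paths ds\<close>: lying weakly above the path \<open>ds\<close>
  means that the stack with supply \<open>ds\<close> never underflows.
\<close>

definition height :: "nat list \<Rightarrow> nat list \<Rightarrow> nat \<Rightarrow> nat" where
  "height ds \<mu> k = sum_list (take k ds) - sum_list (take k \<mu>)"

lemma sum_list_take_Suc:
  "k < length xs \<Longrightarrow> sum_list (take (Suc k) xs) = sum_list (take k xs) + (xs ! k :: nat)"
  by (simp add: take_Suc_conv_app_nth)

lemma sum_list_take_mono:
  "k \<le> l \<Longrightarrow> sum_list (take k xs) \<le> sum_list (take l (xs :: nat list))"
  by (metis le_add1 le_Suc_ex sum_list_append take_add)

lemma nu_paths_iff:
  "\<mu> \<in> nu_paths \<nu> \<longleftrightarrow> length \<mu> = length \<nu> \<and> sum_list \<mu> = sum_list \<nu> \<and>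
     (\<forall>k. sum_list (take k \<mu>) \<le> sum_list (take k \<nu>))"
proof -
  have partial: "(\<Sum>i\<le>j. xs ! i) = sum_list (take (Suc j) xs)" if "j < length xs"
    for j and xs :: "nat list"
    using that
  proof (induction j)
    case 0
    then show ?case by (cases xs) auto
  next
    case (Suc j)
    then show ?case by (simp add: sum_list_take_Suc)
  qed
  show ?thesis
  proof (cases "length \<mu> = length \<nu> \<and> sum_list \<mu> = sum_list \<nu>")
    case True
    have "(\<forall>k. sum_list (take k \<mu>) \<le> sum_list (take k \<nu>)) \<longleftrightarrow>
        (\<forall>j<length \<nu>. sum_list (take (Suc j) \<mu>) \<le> sum_list (take (Suc j) \<nu>))" (is "_ \<longleftrightarrow> ?R")
    proof (intro iffI allI)
      fix k assume R: ?R
      show "sum_list (take k \<mu>) \<le> sum_list (take k \<nu>)"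
      proof (cases "k \<le> length \<nu>")
        case True
        then show ?thesis using R by (cases k) auto
      next
        case False
        then show ?thesis using True by simp
      qed
    qed auto
    then show ?thesis using True by (simp add: nu_paths_def partial)
  next
    case False
    then show ?thesis by (auto simp: nu_paths_def)
  qed
qed

lemma nth_eq_height_drop:
  assumes "\<mu> \<in> nu_paths ds" "k < length ds"
  shows "height ds \<mu> (Suc k) + \<mu> ! k = height ds \<mu> k + ds ! k"
proof -
  have "sum_list (take k \<mu>) \<le> sum_list (take k ds)"
    "sum_list (take (Suc k) \<mu>) \<le> sum_list (take (Suc k) ds)"
    using assms by (auto simp only: nu_paths_iff)
  then show ?thesis using assms by (simp add: height_def sum_list_take_Suc nu_paths_iff)
qed

lemma height_in_profiles:
  assumes "\<mu> \<in> nu_paths ds"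
  shows "height ds \<mu> \<in> height_profiles (length ds) ((!) ds)"
proof -
  have "height ds \<mu> (Suc k) \<le> height ds \<mu> k + ds ! k" if "k < length ds" for k
    using nth_eq_height_drop[OF assms that] by simp
  then show ?thesis using assms by (auto simp: height_profiles_def height_def nu_paths_iff)
qed

lemma inj_on_height: "inj_on (height ds) (nu_paths ds)"
proof (rule inj_onI)
  fix \<mu> \<mu>' assume \<mu>: "\<mu> \<in> nu_paths ds" "\<mu>' \<in> nu_paths ds" and eq: "height ds \<mu> = height ds \<mu>'"
  have "\<mu> ! k = \<mu>' ! k" if "k < length ds" for k
    using nth_eq_height_drop[OF \<mu>(1) that] nth_eq_height_drop[OF \<mu>(2) that] eq by simp
  then show "\<mu> = \<mu>'" using \<mu> by (intro nth_equalityI) (auto simp: nu_paths_iff)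
qed

lemma height_surj:
  assumes P: "P \<in> height_profiles (length ds) ((!) ds)"
  obtains \<mu> where "\<mu> \<in> nu_paths ds" "height ds \<mu> = P"
proof -
  define \<mu> where "\<mu> = map (\<lambda>k. P k + ds ! k - P (Suc k)) [0..<length ds]"
  have len: "length \<mu> = length ds" by (simp add: \<mu>_def)
  have step: "P (Suc k) \<le> P k + ds ! k" if "k < length ds" for k
    using P that by (simp add: height_profiles_def)
  have sums: "sum_list (take k \<mu>) + P k = sum_list (take k ds)" if "k \<le> length ds" for k
    using that
  proof (induction k)
    case 0
    then show ?case using P by (simp add: height_profiles_def)
  next
    case (Suc k)
    then have "\<mu> ! k = P k + ds ! k - P (Suc k)" by (simp add: \<mu>_def)
    then show ?case using Suc step[of k] by (simp add: sum_list_take_Suc len)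
  qed
  have PN: "P k = 0" if "length ds \<le> k" for k using P that by (simp add: height_profiles_def)
  have total: "sum_list \<mu> = sum_list ds" using sums[of "length ds"] PN len by simp
  have ht: "height ds \<mu> k = P k" for k
  proof (cases "k \<le> length ds")
    case True
    then show ?thesis using sums[of k] by (simp add: height_def)
  next
    case False
    then show ?thesis using PN len total by (simp add: height_def)
  qed
  have "sum_list (take k \<mu>) \<le> sum_list (take k ds)" for k
    using sums[of k] len total by (cases "k \<le> length ds") auto
  then have "\<mu> \<in> nu_paths ds" using len total by (simp add: nu_paths_iff)
  then show thesis using that ht by blast
qed

section \<open>Step words\<close>

abbreviation north_rows :: "nat list \<Rightarrow> step list" where
  "north_rows ks \<equiv> concat (map (\<lambda>k. North # replicate k East) ks)"

text \<open>
  The number of the lattice point reached after \<open>e\<close> east steps of row \<open>l\<close>.  With \<open>e \<le> \<mu> ! l\<close> every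
  point of the path has exactly one such description, and points are ordered lexicographically.
\<close>

definition point :: "nat list \<Rightarrow> nat \<Rightarrow> nat \<Rightarrow> nat" where
  "point \<mu> l e = sum_list (take l \<mu>) + l + e"

lemma steps_append: "xs \<noteq> [] \<Longrightarrow> steps (xs @ ys) = steps xs @ north_rows ys"
  by (cases xs) (simp_all add: steps_def)

lemma steps_Cons: "steps (x # xs) = replicate x East @ north_rows xs"
  by (simp add: steps_def)

lemma steps_snoc_add: "steps (xs @ [e + f]) = steps (xs @ [e]) @ replicate f East"
  by (cases xs) (simp_all add: steps_def replicate_add)

lemma steps_split:
  assumes "l < length \<mu>" "e \<le> \<mu> ! l"
  shows "steps \<mu> = steps (take l \<mu> @ [e]) @ replicate (\<mu> ! l - e) East @ north_rows (drop (Suc l) \<mu>)"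
proof -
  have "\<mu> = (take l \<mu> @ [\<mu> ! l]) @ drop (Suc l) \<mu>"
    using assms(1) by (simp add: id_take_nth_drop)
  then have "steps \<mu> = steps (take l \<mu> @ [\<mu> ! l]) @ north_rows (drop (Suc l) \<mu>)"
    by (metis steps_append snoc_eq_iff_butlast)
  also have "steps (take l \<mu> @ [\<mu> ! l]) = steps (take l \<mu> @ [e]) @ replicate (\<mu> ! l - e) East"
    using steps_snoc_add[of "take l \<mu>" e "\<mu> ! l - e"] assms(2) by simp
  finally show ?thesis by simp
qed

lemma count_list_replicate: "count_list (replicate n x) y = (if x = y then n else 0)"
  by (induction n) auto

lemma count_north_rows:
  "count_list (north_rows ks) North = length ks" "count_list (north_rows ks) East = sum_list ks"
  by (induction ks) (auto simp: count_list_replicate)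

lemma count_steps:
  assumes "xs \<noteq> []"
  shows "count_list (steps xs) North = length xs - 1" "count_list (steps xs) East = sum_list xs"
  using assms by (cases xs; simp add: steps_Cons count_north_rows count_list_replicate)+

lemma length_steps: "xs \<noteq> [] \<Longrightarrow> length (steps xs) = sum_list xs + length xs - 1"
proof -
  have "length (north_rows ks) = sum_list ks + length ks" for ks by (induction ks) auto
  then show "xs \<noteq> [] \<Longrightarrow> ?thesis" by (cases xs) (simp_all add: steps_Cons)
qed

lemma length_steps_prefix:
  "l < length \<mu> \<Longrightarrow> length (steps (take l \<mu> @ [e])) = point \<mu> l e"
  by (simp add: length_steps point_def)

lemma take_steps:
  assumes "l < length \<mu>" "e \<le> \<mu> ! l"
  shows "take (point \<mu> l e) (steps \<mu>) = steps (take l \<mu> @ [e])"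
    and "drop (point \<mu> l e) (steps \<mu>) = replicate (\<mu> ! l - e) East @ north_rows (drop (Suc l) \<mu>)"
  using steps_split[OF assms] length_steps_prefix[OF assms(1), of e] by simp_all

lemma point_Suc: "l < length \<mu> \<Longrightarrow> point \<mu> (Suc l) 0 = Suc (point \<mu> l (\<mu> ! l))"
  by (simp add: point_def sum_list_take_Suc)

lemma point_less:
  assumes "l < l'" "l' < length \<mu>" "e \<le> \<mu> ! l"
  shows "point \<mu> l e < point \<mu> l' e'"
proof -
  have "point \<mu> l e < point \<mu> (Suc l) 0" using assms by (simp add: point_Suc) (simp add: point_def)
  also have "\<dots> \<le> point \<mu> l' e'"
    using assms sum_list_take_mono[of "Suc l" l' \<mu>] by (simp add: point_def)
  finally show ?thesis .
qed

lemma point_less_iff: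
  assumes "l < length \<mu>" "l' < length \<mu>" "e \<le> \<mu> ! l" "e' \<le> \<mu> ! l'"
  shows "point \<mu> l e < point \<mu> l' e' \<longleftrightarrow> l < l' \<or> l = l' \<and> e < e'"
proof -
  have "point \<mu> l e < point \<mu> l e' \<longleftrightarrow> e < e'" by (simp add: point_def)
  moreover have "l < l' \<Longrightarrow> point \<mu> l e < point \<mu> l' e'" using assms by (intro point_less) auto
  moreover have "l' < l \<Longrightarrow> point \<mu> l' e' < point \<mu> l e" using assms by (intro point_less) auto
  ultimately show ?thesis by (metis less_asym linorder_neqE_nat)
qed

lemma length_steps_point:
  assumes "\<mu> \<noteq> []"
  shows "length (steps \<mu>) = point \<mu> (length \<mu> - 1) (\<mu> ! (length \<mu> - 1))"
  using steps_split[of "length \<mu> - 1" \<mu> "\<mu> ! (length \<mu> - 1)"]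
    length_steps_prefix[of "length \<mu> - 1" \<mu> "\<mu> ! (length \<mu> - 1)"] assms by simp

lemma point_cases:
  assumes "\<mu> \<noteq> []" "r \<le> length (steps \<mu>)"
  obtains l e where "l < length \<mu>" "e \<le> \<mu> ! l" "r = point \<mu> l e"
proof -
  let ?P = "\<lambda>l. l < length \<mu> \<and> point \<mu> l 0 \<le> r"
  define l where "l = (GREATEST l. ?P l)"
  have l: "?P l"
    unfolding l_def by (rule GreatestI_nat[of ?P 0 "length \<mu>"]) (use assms in \<open>auto simp: point_def\<close>)
  have max: "m \<le> l" if "?P m" for m
    unfolding l_def using that by (rule Greatest_le_nat[of ?P m "length \<mu>"]) auto
  have "r \<le> point \<mu> l (\<mu> ! l)"
  proof (cases "Suc l < length \<mu>")
    case True
    then have "\<not> point \<mu> (Suc l) 0 \<le> r" using max[of "Suc l"] by auto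
    then show ?thesis using l by (simp add: point_Suc)
  next
    case False
    then have "l = length \<mu> - 1" using l by linarith
    then show ?thesis using assms length_steps_point by simp
  qed
  then show thesis using l by (intro that[of l "r - point \<mu> l 0"]) (auto simp: point_def)
qed

lemma point_le_length:
  assumes "l < length \<mu>" "e \<le> \<mu> ! l"
  shows "point \<mu> l e \<le> length (steps \<mu>)"
  using steps_split[OF assms] length_steps_prefix[OF assms(1), of e] by simp

lemma nth_steps_East:
  assumes "l < length \<mu>" "e < \<mu> ! l"
  shows "steps \<mu> ! point \<mu> l e = East"
proof -
  have "drop (point \<mu> l e) (steps \<mu>) ! 0 = East"
    using assms by (subst take_steps(2)) (auto simp: nth_append)
  then show ?thesis using assms point_le_length[of l \<mu> e] by simp
qed

lemma nth_steps_North: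
  assumes "Suc l < length \<mu>"
  shows "steps \<mu> ! point \<mu> l (\<mu> ! l) = North"
proof -
  have "drop (point \<mu> l (\<mu> ! l)) (steps \<mu>) ! 0 = North"
    using assms by (subst take_steps(2)) (auto simp: Cons_nth_drop_Suc[symmetric])
  then show ?thesis using assms point_le_length[of l \<mu> "\<mu> ! l"] by simp
qed

text \<open>
  The leading block of east steps determines the head of the list, even if it is empty; the empty
  list is excluded because it may share its word with other lists.
\<close>

lemma steps_inject:
  assumes "xs \<noteq> []" "ys \<noteq> []" "steps xs = steps ys"
  shows "xs = ys"
proof -
  have tw: "takeWhile (\<lambda>s. s = East) (replicate x East @ north_rows ks) = replicate x East"
    for x ks by (cases ks) (simp_all add: takeWhile_append)
  have "x = y \<and> xs = ys" if "steps (x # xs) = steps (y # ys)" for x xs y ys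
    using that
  proof (induction xs arbitrary: x y ys)
    case Nil
    have "replicate x East = replicate y East"
      using Nil tw[of x "[]"] tw[of y ys] by (simp add: steps_Cons)
    then have "x = y" by (metis length_replicate)
    then show ?case using Nil by (cases ys) (simp_all add: steps_Cons)
  next
    case (Cons z zs)
    have "replicate x East = replicate y East"
      using Cons.prems tw[of x "z # zs"] tw[of y ys] by (simp add: steps_Cons)
    then have xy: "x = y" by (metis length_replicate)
    then have eq: "north_rows (z # zs) = north_rows ys"
      using Cons.prems unfolding steps_Cons by simp
    then obtain y' ys' where ys: "ys = y' # ys'" by (cases ys) auto
    have "steps (z # zs) = steps (y' # ys')" using eq by (simp add: ys steps_Cons)
    then show ?case using Cons.IH xy ys by simp
  qed
  then show ?thesis using assms by (cases xs; cases ys) auto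
qed

text \<open>
  The excursion from \<open>p\<close> to \<open>q\<close> consists of whole rows followed by an initial part of row \<open>k\<close>.  The
  east step reinserted at \<open>q\<close> just lengthens row \<open>k\<close> by one, wherever in that row \<open>q\<close> lies.
\<close>

lemma rotated_steps:
  assumes "l < k" "k < length \<mu>" "0 < \<mu> ! l" "e \<le> \<mu> ! k"
  defines "p \<equiv> point \<mu> l (\<mu> ! l)" and "q \<equiv> point \<mu> k e"
  shows "take (p - 1) (steps \<mu>) @ drop p (take q (steps \<mu>)) @ [East] @ drop q (steps \<mu>) =
    steps (\<mu>[l := \<mu> ! l - 1, k := Suc (\<mu> ! k)])"
proof -
  let ?mid = "drop (Suc l) (take k \<mu>)"
  have l: "l < length \<mu>" using assms by simp
  have "p - 1 = point \<mu> l (\<mu> ! l - 1)" using assms by (simp add: point_def)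
  then have 1: "take (p - 1) (steps \<mu>) = steps (take l \<mu> @ [\<mu> ! l - 1])"
    using take_steps(1)[OF l, of "\<mu> ! l - 1"] by simp
  have "take k \<mu> = take l \<mu> @ [\<mu> ! l] @ ?mid"
    using id_take_nth_drop[of l "take k \<mu>"] assms by simp
  then have "take k \<mu> @ [e] = (take l \<mu> @ [\<mu> ! l]) @ ?mid @ [e]"
    by (metis append.assoc)
  then have "take q (steps \<mu>) = steps ((take l \<mu> @ [\<mu> ! l]) @ ?mid @ [e])"
    unfolding q_def using take_steps(1)[of k \<mu> e] assms(2,4) by metis
  also have "\<dots> = steps (take l \<mu> @ [\<mu> ! l]) @ north_rows (?mid @ [e])"
    by (rule steps_append) simp
  finally have 2: "drop p (take q (steps \<mu>)) = north_rows (?mid @ [e])"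
    using length_steps_prefix[OF l, of "\<mu> ! l"] by (simp add: p_def)
  have 3: "drop q (steps \<mu>) = replicate (\<mu> ! k - e) East @ north_rows (drop (Suc k) \<mu>)"
    unfolding q_def using assms by (intro take_steps(2)) auto
  have "\<mu>[l := \<mu> ! l - 1, k := Suc (\<mu> ! k)] =
      (take l \<mu> @ [\<mu> ! l - 1]) @ ?mid @ Suc (\<mu> ! k) # drop (Suc k) \<mu>"
  proof -
    have "\<mu>[l := \<mu> ! l - 1, k := Suc (\<mu> ! k)] =
        (take k \<mu>)[l := \<mu> ! l - 1] @ Suc (\<mu> ! k) # drop (Suc k) \<mu>"
      using assms by (subst upd_conv_take_nth_drop) (auto simp: take_update_swap)
    also have "(take k \<mu>)[l := \<mu> ! l - 1] = take l \<mu> @ (\<mu> ! l - 1) # ?mid"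
      using assms by (subst upd_conv_take_nth_drop) (auto simp: min_def)
    finally show ?thesis by simp
  qed
  then have "steps (\<mu>[l := \<mu> ! l - 1, k := Suc (\<mu> ! k)]) =
      steps (take l \<mu> @ [\<mu> ! l - 1]) @ north_rows (?mid @ Suc (\<mu> ! k) # drop (Suc k) \<mu>)"
    by (metis steps_append snoc_eq_iff_butlast)
  moreover have "replicate e East @ East # replicate (\<mu> ! k - e) East = replicate (Suc (\<mu> ! k)) East"
    using assms by (metis add_Suc_right le_add_diff_inverse replicate_Suc replicate_add)
  ultimately show ?thesis unfolding 1 2 3 by simp
qed


lemma altitude_eq_height:
  assumes \<mu>: "\<mu> \<in> nu_paths (a # \<delta>)" and l: "l < length \<mu>" "e \<le> \<mu> ! l"
  shows "altitude \<delta> (steps \<mu>) (point \<mu> l e) =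
    int (height (a # \<delta>) \<mu> l + (a # \<delta>) ! l) - int e - int a"
proof -
  have len: "l \<le> length \<delta>" using \<mu> l by (simp add: nu_paths_iff)
  have sums: "(\<Sum>i = 1..l. int (\<delta> ! (i - 1))) = int (sum_list (take l \<delta>))" if "l \<le> length \<delta>" for l
    using that by (induction l) (simp_all add: sum_list_take_Suc)
  have "altitude \<delta> (steps \<mu>) (point \<mu> l e) =
      int (sum_list (take l \<delta>)) - int (sum_list (take l \<mu>) + e)"
    using l sums[OF len] by (simp add: altitude_def take_steps count_steps)
  moreover have "sum_list (take (Suc l) (a # \<delta>)) = sum_list (take l (a # \<delta>)) + (a # \<delta>) ! l"
    using len by (intro sum_list_take_Suc) simp
  moreover have "sum_list (take l \<mu>) \<le> sum_list (take l (a # \<delta>))"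
    using \<mu> by (auto simp only: nu_paths_iff)
  ultimately show ?thesis by (simp add: height_def)
qed

text \<open>
  The altitude rises by jumps but falls by single steps, so it cannot get below the altitude of the
  valley without passing through it.  Hence the first return to that altitude happens in the first
  row that ends at or below it.
\<close>

lemma rotation_iff_rows:
  assumes \<mu>: "\<mu> \<in> nu_paths (a # \<delta>)"
  defines "h \<equiv> height (a # \<delta>) \<mu>"
  shows "rotation \<delta> \<mu> \<mu>' \<longleftrightarrow>
    (\<exists>l k. l < k \<and> k < length \<mu> \<and> 0 < \<mu> ! l \<and> h (Suc k) \<le> h (Suc l) \<and>
       (\<forall>m\<in>{Suc l<..<Suc k}. h (Suc l) < h m) \<and> \<mu>' = \<mu>[l := \<mu> ! l - 1, k := Suc (\<mu> ! k)])"
    (is "_ = ?rows")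
proof -
  let ?w = "steps \<mu>" and ?d = "(!) (a # \<delta>)"
  have len: "length \<mu> = Suc (length \<delta>)" using \<mu> by (simp add: nu_paths_iff)
  then have ne: "\<mu> \<noteq> []" by auto
  have alt: "altitude \<delta> ?w (point \<mu> l e) = int (h l + ?d l) - int e - int a"
    if "l < length \<mu>" "e \<le> \<mu> ! l" for l e
    unfolding h_def by (rule altitude_eq_height[OF \<mu> that])
  have row: "h (Suc l) + \<mu> ! l = h l + ?d l" if "l < length \<mu>" for l
    unfolding h_def using nth_eq_height_drop[OF \<mu>] that len by simp
  have alt_p: "altitude \<delta> ?w (point \<mu> l (\<mu> ! l)) = int (h (Suc l)) - int a"
    if "l < length \<mu>" for l
    using alt[OF that] row[OF that] by simp
  show ?thesis
  proof
    assume "rotation \<delta> \<mu> \<mu>'"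
    then obtain p q where len': "length \<mu>' = length \<mu>"
      and pq: "0 < p" "p < q" "q \<le> length ?w"
      and valley: "?w ! (p - 1) = East" "?w ! p = North"
      and level: "altitude \<delta> ?w q = altitude \<delta> ?w p"
      and next_q: "\<And>r. p < r \<Longrightarrow> r < q \<Longrightarrow> altitude \<delta> ?w r \<noteq> altitude \<delta> ?w p"
      and \<mu>': "steps \<mu>' = take (p - 1) ?w @ drop p (take q ?w) @ [East] @ drop q ?w"
      by (auto simp: rotation_def Let_def)
    obtain l e where l: "l < length \<mu>" "e \<le> \<mu> ! l" and p: "p = point \<mu> l e"
      using point_cases[OF ne, of p] pq by auto
    obtain k f where k: "k < length \<mu>" "f \<le> \<mu> ! k" and q: "q = point \<mu> k f"
      using point_cases[OF ne pq(3)] by auto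
    have e: "e = \<mu> ! l"
      using nth_steps_East[OF l(1), of e] valley(2) l(2) p by (cases "e = \<mu> ! l") auto
    have lk: "l < k" using pq(2) point_less_iff[OF l(1) k(1) l(2) k(2)] e k p q by auto
    have pos: "0 < \<mu> ! l"
    proof (rule ccontr)
      assume "\<not> 0 < \<mu> ! l"
      then have "p = point \<mu> l 0" using p e by simp
      moreover from this obtain l' where "l = Suc l'" using pq(1) by (cases l) (auto simp: point_def)
      ultimately have "?w ! (p - 1) = North"
        using l(1) by (simp add: point_Suc nth_steps_North)
      then show False using valley(1) by simp
    qed
    have level': "h k + ?d k = h (Suc l) + f"
      using level alt[OF k] alt_p[OF l(1)] p q e by simp
    then have top: "h (Suc k) \<le> h (Suc l)" using row[OF k(1)] k(2) by simp
    \<comment> \<open>The first row \<open>m'\<close> to end too low would pass the altitude of the valley at a point before \<open>q\<close>.\<close>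
    have "h (Suc l) < h m" if m: "Suc l < m" "m < Suc k" for m
    proof (rule ccontr)
      let ?low = "\<lambda>m. Suc l < m \<and> h m \<le> h (Suc l)"
      assume "\<not> h (Suc l) < h m"
      then have low: "?low m" using m by simp
      define m' where "m' = (LEAST m. ?low m) - 1"
      have least: "?low (LEAST m. ?low m)" using low by (rule LeastI)
      then have m': "(LEAST m. ?low m) = Suc m'" by (simp add: m'_def)
      have "Suc m' \<le> m" unfolding m'[symmetric] using low by (rule Least_le)
      then have m'k: "l < m'" "m' < k" using m least m' by auto
      have above: "h (Suc l) \<le> h m'"
        using not_less_Least[of m' ?low] m' m'k(1) by (cases "m' = Suc l") auto
      have m'_len: "m' < length \<mu>" using m'k k by simp
      define g where "g = h m' + ?d m' - h (Suc l)"
      have g: "g \<le> \<mu> ! m'" using least row[OF m'_len] unfolding m' g_def by linarith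
      have "altitude \<delta> ?w (point \<mu> m' g) = altitude \<delta> ?w p"
        using alt[OF m'_len g] alt_p[OF l(1)] above p e by (simp add: g_def of_nat_diff)
      moreover have "p < point \<mu> m' g" "point \<mu> m' g < q"
        using m'k l k g m'_len p q by (auto intro: point_less)
      ultimately show False using next_q by blast
    qed
    moreover have "\<mu>' = \<mu>[l := \<mu> ! l - 1, k := Suc (\<mu> ! k)]"
    proof (rule steps_inject)
      show "\<mu>' \<noteq> []" using len' ne by auto
      show "steps \<mu>' = steps (\<mu>[l := \<mu> ! l - 1, k := Suc (\<mu> ! k)])"
        using \<mu>' rotated_steps[OF lk k(1) pos k(2)] by (simp add: p q e)
    qed (use ne in simp)
    ultimately show ?rows
      using lk k(1) pos top by (intro exI[of _ l] exI[of _ k]) auto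
  next
    assume ?rows
    then obtain l k where lk: "l < k" and k: "k < length \<mu>" and pos: "0 < \<mu> ! l"
      and top: "h (Suc k) \<le> h (Suc l)"
      and above: "\<And>m. Suc l < m \<Longrightarrow> m < Suc k \<Longrightarrow> h (Suc l) < h m"
      and \<mu>': "\<mu>' = \<mu>[l := \<mu> ! l - 1, k := Suc (\<mu> ! k)]" by auto
    have l: "l < length \<mu>" using lk k by simp
    define p where "p = point \<mu> l (\<mu> ! l)"
    define f where "f = h k + ?d k - h (Suc l)"
    define q where "q = point \<mu> k f"
    have f: "f \<le> \<mu> ! k" using row[OF k] top by (simp add: f_def)
    have "h (Suc l) \<le> h k"
      using above[of k] lk by (cases "k = Suc l") auto
    then have f_eq: "h k + ?d k = h (Suc l) + f" by (simp add: f_def)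
    have "0 < p" using pos by (simp add: p_def point_def)
    moreover have "p < q" unfolding p_def q_def using lk k by (intro point_less) auto
    moreover have "q \<le> length ?w" unfolding q_def by (rule point_le_length[OF k f])
    moreover have "?w ! (p - 1) = East"
    proof -
      have "p - 1 = point \<mu> l (\<mu> ! l - 1)" using pos by (simp add: p_def point_def)
      then show ?thesis using nth_steps_East[OF l, of "\<mu> ! l - 1"] pos by simp
    qed
    moreover have "?w ! p = North" unfolding p_def using lk k by (intro nth_steps_North) simp
    moreover have "altitude \<delta> ?w q = altitude \<delta> ?w p"
      unfolding p_def q_def alt_p[OF l] alt[OF k f] f_eq by simp
    moreover have "altitude \<delta> ?w r \<noteq> altitude \<delta> ?w p" if r: "p < r" "r < q" for r
    proof -
      obtain m g where m: "m < length \<mu>" "g \<le> \<mu> ! m" and rm: "r = point \<mu> m g"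
        using point_cases[OF ne, of r] r \<open>q \<le> length ?w\<close> by auto
      have "l < m" using r(1) point_less_iff[OF l m(1) _ m(2)] m by (auto simp: p_def rm)
      have "m < k \<or> m = k \<and> g < f"
        using r(2) point_less_iff[OF m(1) k m(2) f] by (simp add: q_def rm)
      then have "h (Suc l) + g < h m + ?d m"
      proof
        assume "m < k"
        then have "h (Suc l) < h (Suc m)" using \<open>l < m\<close> by (intro above) auto
        then show ?thesis using row[OF m(1)] m(2) by linarith
      next
        assume "m = k \<and> g < f"
        then show ?thesis using f_eq by simp
      qed
      then show ?thesis unfolding rm p_def alt_p[OF l] alt[OF m] by simp
    qed
    moreover have "steps \<mu>' = take (p - 1) ?w @ drop p (take q ?w) @ [East] @ drop q ?w"
      unfolding \<mu>' p_def q_def by (rule rotated_steps[OF lk k pos f, symmetric])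
    ultimately show "rotation \<delta> \<mu> \<mu>'"
      unfolding rotation_def Let_def using \<mu>' by (intro conjI exI[of _ p] exI[of _ q]) auto
  qed
qed

lemma sum_list_take_transfer:
  fixes \<mu> :: "nat list"
  assumes "l < k" "k < length \<mu>" "0 < \<mu> ! l"
  shows "sum_list (take m (\<mu>[l := \<mu> ! l - 1, k := Suc (\<mu> ! k)])) + (if l < m \<and> m \<le> k then 1 else 0) =
    sum_list (take m \<mu>)"
proof -
  let ?\<mu>' = "\<mu>[l := \<mu> ! l - 1, k := Suc (\<mu> ! k)]"
  have bounded: "sum_list (take m ?\<mu>') + (if l < m \<and> m \<le> k then 1 else 0) = sum_list (take m \<mu>)"
    if "m \<le> length \<mu>" for m
    using that
  proof (induction m)
    case (Suc m)
    then have IH: "sum_list (take m ?\<mu>') + (if l < m \<and> m \<le> k then 1 else 0) = sum_list (take m \<mu>)"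
      by simp
    have "?\<mu>' ! m = (if m = k then Suc (\<mu> ! k) else if m = l then \<mu> ! l - 1 else \<mu> ! m)"
      using Suc.prems assms by (auto simp: nth_list_update)
    then show ?case using IH Suc.prems assms by (auto simp: sum_list_take_Suc split: if_splits)
  qed simp
  show ?thesis
  proof (cases "m \<le> length \<mu>")
    case False
    then show ?thesis using bounded[of "length \<mu>"] assms(2) by simp
  qed (rule bounded)
qed

lemma rotation_iff_profile_rotation:
  assumes \<mu>: "\<mu> \<in> nu_paths (a # \<delta>)"
  shows "rotation \<delta> \<mu> \<mu>' \<longleftrightarrow> \<mu>' \<in> nu_paths (a # \<delta>) \<and>
    profile_rotation (length \<mu>) ((!) (a # \<delta>)) (height (a # \<delta>) \<mu>) (height (a # \<delta>) \<mu>')"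
proof -
  let ?ds = "a # \<delta>"
  let ?h = "height ?ds \<mu>"
  let ?move = "\<lambda>l k. \<mu>[l := \<mu> ! l - 1, k := Suc (\<mu> ! k)]"
  have len: "length \<mu> = length ?ds" using \<mu> by (simp add: nu_paths_iff)
  have dom: "sum_list (take m \<mu>) \<le> sum_list (take m ?ds)" for m
    using \<mu> by (auto simp only: nu_paths_iff)
  have moved: "?move l k \<in> nu_paths ?ds"
    "height ?ds (?move l k) = (\<lambda>m. if Suc l \<le> m \<and> m < Suc k then Suc (?h m) else ?h m)"
    if lk: "l < k" "k < length \<mu>" "0 < \<mu> ! l" for l k
  proof -
    note sums = sum_list_take_transfer[OF lk]
    have "sum_list (?move l k) = sum_list \<mu>"
      using sums[of "length \<mu>"] lk by simp
    moreover have "sum_list (take m (?move l k)) \<le> sum_list (take m ?ds)" for m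
      using sums[of m] dom[of m] by linarith
    ultimately show "?move l k \<in> nu_paths ?ds" using \<mu> by (auto simp only: nu_paths_iff length_list_update)
    have "height ?ds (?move l k) m = (if Suc l \<le> m \<and> m < Suc k then Suc (?h m) else ?h m)" for m
      using sums[of m] dom[of m] unfolding height_def by (auto split: if_splits)
    then show "height ?ds (?move l k) = (\<lambda>m. if Suc l \<le> m \<and> m < Suc k then Suc (?h m) else ?h m)"
      by blast
  qed
  have drop_pos: "?h (Suc l) < ?h l + ?ds ! l \<longleftrightarrow> 0 < \<mu> ! l" if "l < length \<mu>" for l
    using nth_eq_height_drop[OF \<mu>, of l] that len by linarith
  show ?thesis
  proof
    assume "rotation \<delta> \<mu> \<mu>'"
    then obtain l k where lk: "l < k" "k < length \<mu>" "0 < \<mu> ! l"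
      and top: "?h (Suc k) \<le> ?h (Suc l)" "\<forall>m\<in>{Suc l<..<Suc k}. ?h (Suc l) < ?h m"
      and \<mu>': "\<mu>' = ?move l k"
      unfolding rotation_iff_rows[OF \<mu>] by blast
    have "profile_rotation (length \<mu>) ((!) ?ds) ?h (height ?ds \<mu>')"
      unfolding profile_rotation_def \<mu>' moved(2)[OF lk]
      using lk top drop_pos[of l] by (intro exI[of _ "Suc l"] exI[of _ "Suc k"]) auto
    then show "\<mu>' \<in> nu_paths ?ds \<and> profile_rotation (length \<mu>) ((!) ?ds) ?h (height ?ds \<mu>')"
      using moved(1)[OF lk] \<mu>' by simp
  next
    assume R: "\<mu>' \<in> nu_paths ?ds \<and> profile_rotation (length \<mu>) ((!) ?ds) ?h (height ?ds \<mu>')"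
    then obtain j K where jK: "0 < j" "j < K" "K \<le> length \<mu>" "?h j < ?h (j - 1) + ?ds ! (j - 1)"
      and top: "?h K \<le> ?h j" "\<forall>l\<in>{j<..<K}. ?h j < ?h l"
      and h': "height ?ds \<mu>' = (\<lambda>l. if j \<le> l \<and> l < K then Suc (?h l) else ?h l)"
      unfolding profile_rotation_def by blast
    obtain l where l: "j = Suc l" using jK(1) by (cases j) auto
    obtain k where k: "K = Suc k" using jK(2) by (cases K) auto
    have lk: "l < k" "k < length \<mu>" "0 < \<mu> ! l" using jK drop_pos[of l] by (auto simp: l k)
    have "height ?ds \<mu>' = height ?ds (?move l k)"
      unfolding moved(2)[OF lk] h' l k ..
    then have "\<mu>' = ?move l k"
      using inj_onD[OF inj_on_height] moved(1)[OF lk] R by blast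
    then show "rotation \<delta> \<mu> \<mu>'"
      unfolding rotation_iff_rows[OF \<mu>] using lk top unfolding l k by blast
  qed
qed

section \<open>The lattice\<close>

lemma lattice_if_Inter_closed_embedding:
  fixes L :: "'a gorder" and \<phi> :: "'a \<Rightarrow> 'b set"
  assumes eq: "eq L = (=)"
    and inj: "inj_on \<phi> (carrier L)"
    and le: "\<And>x y. x \<in> carrier L \<Longrightarrow> y \<in> carrier L \<Longrightarrow> x \<sqsubseteq>\<^bsub>L\<^esub> y \<longleftrightarrow> \<phi> x \<subseteq> \<phi> y"
    and Inter: "\<And>F. F \<noteq> {} \<Longrightarrow> F \<subseteq> \<phi> ` carrier L \<Longrightarrow> \<Inter>F \<in> \<phi> ` carrier L"
    and top: "t \<in> carrier L" "\<And>x. x \<in> carrier L \<Longrightarrow> \<phi> x \<subseteq> \<phi> t"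
  shows "lattice L"
proof -
  interpret partial_order L
  proof
    fix x y assume "x \<in> carrier L" "y \<in> carrier L" "x \<sqsubseteq>\<^bsub>L\<^esub> y" "y \<sqsubseteq>\<^bsub>L\<^esub> x"
    then have "\<phi> x = \<phi> y" using le by blast
    then show "x .=\<^bsub>L\<^esub> y" using inj \<open>x \<in> carrier L\<close> \<open>y \<in> carrier L\<close> by (simp add: eq inj_on_eq_iff)
  next
    fix x y z assume "x \<in> carrier L" "y \<in> carrier L" "z \<in> carrier L" "x \<sqsubseteq>\<^bsub>L\<^esub> y" "y \<sqsubseteq>\<^bsub>L\<^esub> z"
    then show "x \<sqsubseteq>\<^bsub>L\<^esub> z" using le by (meson subset_trans)
  next
    show "x \<sqsubseteq>\<^bsub>L\<^esub> x" if "x \<in> carrier L" for x using le[OF that that] by simp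
  qed (simp_all add: eq)
  have meet: "\<exists>m\<in>carrier L. \<phi> m = \<Inter>(\<phi> ` A)" if "A \<subseteq> carrier L" "A \<noteq> {}" for A
  proof -
    have "\<Inter>(\<phi> ` A) \<in> \<phi> ` carrier L" using that by (intro Inter) auto
    then show ?thesis by (metis imageE)
  qed
  show ?thesis
  proof
    fix x y assume x: "x \<in> carrier L" and y: "y \<in> carrier L"
    let ?U = "Upper L {x, y}"
    have U: "u \<in> ?U \<longleftrightarrow> u \<in> carrier L \<and> \<phi> x \<subseteq> \<phi> u \<and> \<phi> y \<subseteq> \<phi> u" for u
      using x y le by (auto simp: Upper_def)
    have "t \<in> ?U" using top x y by (simp add: U)
    then obtain s where s: "s \<in> carrier L" "\<phi> s = \<Inter>(\<phi> ` ?U)"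
      using meet[of ?U] by auto
    have "least L s ?U"
      unfolding least_def using s by (auto simp: U le)
    then show "\<exists>s. least L s ?U" ..
  next
    fix x y assume x: "x \<in> carrier L" and y: "y \<in> carrier L"
    obtain m where m: "m \<in> carrier L" "\<phi> m = \<Inter>(\<phi> ` {x, y})" using meet[of "{x, y}"] x y by auto
    have lower: "u \<in> Lower L {x, y} \<longleftrightarrow> u \<in> carrier L \<and> \<phi> u \<subseteq> \<phi> x \<and> \<phi> u \<subseteq> \<phi> y" for u
      using x y le by (auto simp: Lower_def)
    have "greatest L m (Lower L {x, y})"
      unfolding greatest_def using m by (auto simp: lower le)
    then show "\<exists>s. greatest L s (Lower L {x, y})" ..
  qed
qed

text \<open>
  If \<open>R\<close> does not rise after row 0, then each later row pops all its own units at once, and the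
  only pending units of \<open>R\<close> come from row 0.  Their levels are the same in every profile, so their
  waiting times are governed by the height alone.
\<close>

lemma pending_subset_iff_le:
  assumes P: "P \<in> height_profiles N d" and R: "R \<in> height_profiles N d"
    and decreasing: "\<And>k. 0 < k \<Longrightarrow> k < N \<Longrightarrow> R (Suc k) \<le> R k"
  shows "pending d R \<subseteq> pending d P \<longleftrightarrow> (\<forall>k. R k \<le> P k)"
proof
  assume "pending d R \<subseteq> pending d P"
  then show "\<forall>k. R k \<le> P k" using profile_le_if_pending_subset[OF R P] by blast
next
  assume le: "\<forall>k. R k \<le> P k"
  have zero: "R 0 = 0" "P 0 = 0" using P R by (simp_all add: height_profiles_def)
  show "pending d R \<subseteq> pending d P"
  proof clarify
    fix i c k assume ick: "(i, c, k) \<in> pending d R"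
    then have k: "k < N" using bracketing_pending[OF R] unfolding bracketing_def by blast
    have "i = 0"
    proof (rule ccontr)
      assume "i \<noteq> 0"
      then have "R (Suc i) \<le> R i" using ick k by (intro decreasing) (auto simp: pending_def)
      moreover have "R i + c \<le> R (Suc i)" "1 \<le> c" using ick by (auto simp: pending_def)
      ultimately show False by simp
    qed
    then have "\<forall>l\<in>{0<..k}. c \<le> R l" using ick zero by (auto simp: pending_def)
    then have "\<forall>l\<in>{0<..k}. c \<le> P l" using le by (meson le_trans)
    then show "(i, c, k) \<in> pending d P" using ick \<open>i = 0\<close> zero by (simp add: pending_def)
  qed
qed

definition path_pending :: "nat list \<Rightarrow> nat list \<Rightarrow> (nat \<times> nat \<times> nat) set" where
  "path_pending ds \<mu> = pending ((!) ds) (height ds \<mu>)"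

lemma inj_on_path_pending: "inj_on (path_pending ds) (nu_paths ds)"
proof (rule inj_onI)
  fix x y assume xy: "x \<in> nu_paths ds" "y \<in> nu_paths ds" "path_pending ds x = path_pending ds y"
  then have "height ds x = height ds y"
    unfolding path_pending_def by (metis depth_pending height_in_profiles)
  then show "x = y" using inj_onD[OF inj_on_height] xy by blast
qed

lemma path_pending_image:
  "path_pending ds ` nu_paths ds = {X. bracketing (length ds) ((!) ds) X}"
proof
  show "path_pending ds ` nu_paths ds \<subseteq> {X. bracketing (length ds) ((!) ds) X}"
    using bracketing_pending[OF height_in_profiles] by (auto simp: path_pending_def)
  show "{X. bracketing (length ds) ((!) ds) X} \<subseteq> path_pending ds ` nu_paths ds"
  proof clarify
    fix X assume X: "bracketing (length ds) ((!) ds) X"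
    obtain \<mu> where \<mu>: "\<mu> \<in> nu_paths ds" "height ds \<mu> = depth X"
      using height_surj[OF pending_depth(1)[OF X]] by blast
    then have "path_pending ds \<mu> = X" using pending_depth(2)[OF X] by (simp add: path_pending_def)
    then show "X \<in> path_pending ds ` nu_paths ds" using \<mu>(1) by blast
  qed
qed

lemma nu_paths_mono: "\<nu> \<in> nu_paths ds \<Longrightarrow> nu_paths \<nu> \<subseteq> nu_paths ds"
  unfolding nu_paths_iff subset_iff by (metis le_trans)

text \<open>
  Rows of \<open>\<nu>\<close> that use up at least their own supply make its height weakly decreasing after row 0,
  so lying above \<open>\<nu>\<close>, a condition on heights, becomes a condition on pending units.
\<close>

lemma nu_paths_iff_path_pending:
  assumes \<nu>: "\<nu> \<in> nu_paths ds" and ge: "\<And>k. 0 < k \<Longrightarrow> k < length ds \<Longrightarrow> ds ! k \<le> \<nu> ! k"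
    and \<mu>: "\<mu> \<in> nu_paths ds"
  shows "\<mu> \<in> nu_paths \<nu> \<longleftrightarrow> path_pending ds \<nu> \<subseteq> path_pending ds \<mu>"
proof -
  have "height ds \<nu> (Suc k) \<le> height ds \<nu> k" if "0 < k" "k < length ds" for k
    using ge[OF that] nth_eq_height_drop[OF \<nu>, of k] that by simp
  then have "path_pending ds \<nu> \<subseteq> path_pending ds \<mu> \<longleftrightarrow> (\<forall>k. height ds \<nu> k \<le> height ds \<mu> k)"
    unfolding path_pending_def
    by (rule pending_subset_iff_le[OF height_in_profiles[OF \<mu>] height_in_profiles[OF \<nu>]])
  also have "\<dots> \<longleftrightarrow> (\<forall>k. sum_list (take k \<mu>) \<le> sum_list (take k \<nu>))"
  proof -
    have "sum_list (take k \<mu>) \<le> sum_list (take k ds)" "sum_list (take k \<nu>) \<le> sum_list (take k ds)" for k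
      using \<mu> \<nu> by (auto simp only: nu_paths_iff)
    then have "height ds \<nu> k \<le> height ds \<mu> k \<longleftrightarrow> sum_list (take k \<mu>) \<le> sum_list (take k \<nu>)" for k
      unfolding height_def by (metis diff_le_mono2 le_diff_iff')
    then show ?thesis by simp
  qed
  finally show ?thesis using \<mu> \<nu> by (simp add: nu_paths_iff)
qed

text \<open>
  The rotation towards \<open>y\<close> never leaves the \<open>\<nu>\<close>-paths, which are closed upwards, and it increases the
  sum of the heights, which stays bounded by that of \<open>y\<close>; so repeating it ends at \<open>y\<close>.
\<close>

lemma rotations_iff_path_pending_subset:
  fixes a :: nat and \<delta> :: "nat list"
  defines "ds \<equiv> a # \<delta>"
  assumes \<nu>: "\<nu> \<in> nu_paths ds" and ge: "\<And>k. 0 < k \<Longrightarrow> k < length ds \<Longrightarrow> ds ! k \<le> \<nu> ! k"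
    and x: "x \<in> nu_paths \<nu>" and y: "y \<in> nu_paths \<nu>"
  shows "(\<lambda>\<mu> \<mu>'. \<mu> \<in> nu_paths \<nu> \<and> rotation \<delta> \<mu> \<mu>')\<^sup>*\<^sup>* x y \<longleftrightarrow>
    path_pending ds x \<subseteq> path_pending ds y"
proof -
  let ?N = "length ds" and ?d = "(!) ds" and ?\<phi> = "path_pending ds"
  define step where "step \<mu> \<mu>' \<longleftrightarrow> \<mu> \<in> nu_paths \<nu> \<and> rotation \<delta> \<mu> \<mu>'" for \<mu> \<mu>'
  have sub: "\<mu> \<in> nu_paths ds" if "\<mu> \<in> nu_paths \<nu>" for \<mu>
    using nu_paths_mono[OF \<nu>] that by blast
  note above = nu_paths_iff_path_pending[OF \<nu> ge]
  have rot: "rotation \<delta> \<mu> \<mu>' \<longleftrightarrow> \<mu>' \<in> nu_paths ds \<and>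
      profile_rotation ?N ?d (height ds \<mu>) (height ds \<mu>')" if "\<mu> \<in> nu_paths \<nu>" for \<mu> \<mu>'
    using rotation_iff_profile_rotation[of \<mu> a \<delta> \<mu>'] sub[OF that]
    by (simp add: ds_def[symmetric] nu_paths_iff)
  have step_up: "\<mu>' \<in> nu_paths \<nu> \<and> ?\<phi> \<mu> \<subseteq> ?\<phi> \<mu>'" if "step \<mu> \<mu>'" for \<mu> \<mu>'
  proof -
    have \<mu>: "\<mu> \<in> nu_paths \<nu>" and R: "\<mu>' \<in> nu_paths ds"
      "profile_rotation ?N ?d (height ds \<mu>) (height ds \<mu>')"
      using that rot unfolding step_def by blast+
    have "?\<phi> \<mu> \<subseteq> ?\<phi> \<mu>'" unfolding path_pending_def by (rule pending_subset_if_rotation[OF R(2)])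
    then show ?thesis using above \<mu> R(1) sub by blast
  qed
  have "?\<phi> x \<subseteq> ?\<phi> y" if "step\<^sup>*\<^sup>* x y"
    using that by (induction rule: rtranclp_induct) (use step_up in auto)
  moreover have "step\<^sup>*\<^sup>* x y" if "?\<phi> x \<subseteq> ?\<phi> y"
    using x that
  proof (induction "sum (height ds y) {..?N} - sum (height ds x) {..?N}" arbitrary: x rule: less_induct)
    case less
    note px = height_in_profiles[OF sub[OF less.prems(1)]] and py = height_in_profiles[OF sub[OF y]]
    show ?case
    proof (cases "x = y")
      case False
      then have "height ds x \<noteq> height ds y"
        using inj_onD[OF inj_on_height] sub less.prems(1) y by blast
      then obtain P where P: "profile_rotation ?N ?d (height ds x) P" "pending ?d P \<subseteq> ?\<phi> y"
        using rotation_towards[OF px py] less.prems(2) unfolding path_pending_def by blast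
      have P_profile: "P \<in> height_profiles ?N ?d" by (rule profile_rotation_closed[OF px P(1)])
      then obtain z where z: "z \<in> nu_paths ds" "height ds z = P" by (rule height_surj)
      have xz: "step x z" using rot less.prems(1) z P(1) unfolding step_def by blast
      have zy: "?\<phi> z \<subseteq> ?\<phi> y" using z P(2) by (simp add: path_pending_def)
      have "sum (height ds x) {..?N} < sum (height ds z) {..?N}"
        using profile_rotation_sum_less[OF P(1)] z by simp
      moreover have "sum (height ds z) {..?N} \<le> sum (height ds y) {..?N}"
        using profile_le_if_pending_subset[OF P_profile py] P(2) z
        by (intro sum_mono) (simp add: path_pending_def)
      ultimately have "step\<^sup>*\<^sup>* z y" using step_up[OF xz] zy by (intro less.hyps) auto
      with xz show ?thesis by (rule converse_rtranclp_into_rtranclp)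
    qed simp
  qed
  ultimately show ?thesis unfolding step_def[abs_def] by blast
qed

text \<open>
  The north steps supply \<open>sum_list \<delta>\<close> units for \<open>sum_list \<nu>\<close> east steps; row 0 supplies the
  difference, so that every path ends with an empty stack.
\<close>

lemma increment_vector_supply:
  assumes "\<nu> \<noteq> []" "increment_vector \<nu> \<delta>"
  defines "ds \<equiv> (sum_list \<nu> - sum_list \<delta>) # \<delta>"
  shows "\<nu> \<in> nu_paths ds" "\<And>k. 0 < k \<Longrightarrow> k < length ds \<Longrightarrow> ds ! k \<le> \<nu> ! k"
proof -
  have len: "length \<nu> = Suc (length \<delta>)"
    using assms(1,2) by (cases \<nu>) (auto simp: increment_vector_def)
  have \<delta>_le: "\<delta> ! k \<le> \<nu> ! Suc k" if "k < length \<delta>" for k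
  proof -
    have "Suc k \<in> {1..length \<nu> - 1}" using that len by simp
    then have "\<delta> ! (Suc k - 1) \<le> \<nu> ! Suc k" using assms(2) unfolding increment_vector_def by blast
    then show ?thesis by simp
  qed
  show "ds ! k \<le> \<nu> ! k" if "0 < k" "k < length ds" for k
    using \<delta>_le[of "k - 1"] that by (cases k) (auto simp: ds_def)
  have split: "sum_list xs = sum_list (take m xs) + sum_list (drop m xs)" for m and xs :: "nat list"
    by (metis append_take_drop_id sum_list_append)
  have tails: "sum_list (drop k \<delta>) \<le> sum_list (drop (Suc k) \<nu>)" for k
  proof -
    have "list_all2 (\<le>) (drop k \<delta>) (drop (Suc k) \<nu>)"
      using len \<delta>_le by (simp add: list_all2_conv_all_nth)
    then show ?thesis by (induction rule: list_all2_induct) auto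
  qed
  have total: "sum_list \<delta> \<le> sum_list \<nu>" using tails[of 0] split[of \<nu> 1] by simp
  have "sum_list (take k \<nu>) \<le> sum_list (take k ds)" for k
  proof (cases k)
    case (Suc m)
    have "sum_list (take (Suc m) \<nu>) \<le> sum_list \<nu> - sum_list \<delta> + sum_list (take m \<delta>)"
      using tails[of m] split[of \<nu> "Suc m"] split[of \<delta> m] total by linarith
    then show ?thesis by (simp add: Suc ds_def)
  qed simp
  then show "\<nu> \<in> nu_paths ds" using len total by (simp add: nu_paths_iff ds_def)
qed

theorem corollary4p5:
  fixes \<nu> \<delta> :: "nat list"
  assumes "\<nu> \<noteq> []"
    and "increment_vector \<nu> \<delta>"
  shows "lattice (alt_tamari \<nu> \<delta>)"
proof -
  define ds where "ds = (sum_list \<nu> - sum_list \<delta>) # \<delta>"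
  let ?L = "alt_tamari \<nu> \<delta>" and ?\<phi> = "path_pending ds" and ?N = "length ds" and ?d = "(!) ds"
  note base = increment_vector_supply[OF assms, folded ds_def]
  note sub = nu_paths_mono[OF base(1)]
  have car: "carrier ?L = nu_paths \<nu>" by (simp add: alt_tamari_def)
  have image: "?\<phi> ` nu_paths \<nu> = {X. bracketing ?N ?d X \<and> ?\<phi> \<nu> \<subseteq> X}"
  proof -
    have "\<mu> \<in> nu_paths \<nu> \<longleftrightarrow> \<mu> \<in> nu_paths ds \<and> ?\<phi> \<nu> \<subseteq> ?\<phi> \<mu>" for \<mu>
      using nu_paths_iff_path_pending[OF base, of \<mu>] sub by blast
    then have "?\<phi> ` nu_paths \<nu> = {X \<in> ?\<phi> ` nu_paths ds. ?\<phi> \<nu> \<subseteq> X}" by blast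
    then show ?thesis unfolding path_pending_image by simp
  qed
  \<comment> \<open>In the top element every unit waits until the last row.\<close>
  define T where "T = {(i, c, k). i < k \<and> k < ?N \<and> 1 \<le> c \<and> c \<le> ?d i}"
  have below_T: "X \<subseteq> T" if "bracketing ?N ?d X" for X
    using that unfolding bracketing_def T_def by blast
  have "bracketing ?N ?d T" unfolding bracketing_def T_def by auto
  moreover have "bracketing ?N ?d (?\<phi> \<nu>)" using path_pending_image[of ds] base(1) by blast
  ultimately have "T \<in> ?\<phi> ` nu_paths \<nu>" using below_T unfolding image by blast
  then obtain t where t: "t \<in> nu_paths \<nu>" "?\<phi> t = T" by blast
  show ?thesis
  proof (rule lattice_if_Inter_closed_embedding)
    show "eq ?L = (=)" by (simp add: alt_tamari_def)
    show "inj_on ?\<phi> (carrier ?L)" unfolding car by (rule inj_on_subset[OF inj_on_path_pending sub])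
    show "x \<sqsubseteq>\<^bsub>?L\<^esub> y \<longleftrightarrow> ?\<phi> x \<subseteq> ?\<phi> y" if "x \<in> carrier ?L" "y \<in> carrier ?L" for x y
      using rotations_iff_path_pending_subset[OF base[unfolded ds_def], folded ds_def, of x y] that
      unfolding car by (simp add: alt_tamari_def)
    show "\<Inter>F \<in> ?\<phi> ` carrier ?L" if "F \<noteq> {}" "F \<subseteq> ?\<phi> ` carrier ?L" for F
    proof -
      have F: "bracketing ?N ?d X" "?\<phi> \<nu> \<subseteq> X" if "X \<in> F" for X
        using \<open>F \<subseteq> _\<close> that unfolding car image by blast+
      have "bracketing ?N ?d (\<Inter>F)" using \<open>F \<noteq> {}\<close> F(1) by (rule bracketing_Inter)
      moreover have "?\<phi> \<nu> \<subseteq> \<Inter>F" using F(2) by blast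
      ultimately show ?thesis unfolding car image by blast
    qed
    show "t \<in> carrier ?L" unfolding car by (rule t(1))
    show "?\<phi> x \<subseteq> ?\<phi> t" if "x \<in> carrier ?L" for x
    proof -
      have "?\<phi> x \<in> ?\<phi> ` nu_paths \<nu>" using that unfolding car by blast
      then show ?thesis using below_T unfolding image t(2) by blast
    qed
  qed
qed

end
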